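(* Let $(G,\omega,\mu)$ be a connected, locally finite weighted graph, let $d$ be a distance on $G$, let $V:G\to\mathbb{R}$ with $V\ge 0$, and let $x_0\in G$. Suppose that there exists a function $Z:G\to\mathbb{R}$, bounded from above, such that $$\Delta Z(x)\ge -V(x)\quad\text{for all }x\in G,\qquad \lim_{d(x,x_0)\to+\infty}Z(x)=-\infty .$$ Let $u:G\to\mathbb{R}$ be a subsolution of $\Delta u-Vu=0$ in $G$ such that $$\limsup_{d(x,x_0)\to+\infty}\frac{u(x)}{|Z(x)|}\le 0 .$$ Then $u(x)\le 0$ for all $x\in G$.
   Context: A weighted graph is a triplet $(G,\omega,\mu)$ where $G$ is a countably infinite set, $\mu:G\to(0,+\infty)$ is the node measure, and $\omega:G\times G\to[0,+\infty)$ is the edge weight, satisfying $\omega(x,y)=\omega(y,x)$, $\omega(x,x)=0$ and $\sum_{y\in G}\omega(x,y)<\infty$ for all $x,y\in G$. Write $x\sim y$ if $\omega(x,y)>0$. A path is a finite sequence of vertices $x_0,\dots,x_n$ with $x_k\sim x_{k+1}$ for all $k=0,\dots,n-1$. The graph is connected if any two distinct vertices are joined by a path, and locally finite if every $x\in G$ has only finitely many $y\in G$ with $x\sim y$. The distance $d:G\times G\to[0,+\infty)$ is an arbitrary distance on $G$. The Laplace operator is $\Delta f(x)=\frac1{\mu(x)}\sum_{y\in G}[f(y)-f(x)]\,\omega(x,y)$ for $f:G\to\mathbb{R}$, $x\in G$. A function $u:G\to\mathbb{R}$ is a subsolution of $\Delta u-Vu=0$ in $G$ if $\Delta u(x)-V(x)u(x)\ge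 0$ for every $x\in G$.
   Formalization: The formal theorem additionally assumes that all balls of d around x_0 are finite; for an arbitrary distance the claim fails, e.g. for bounded d with V=0, Z=0, u=1, where both limit conditions are vacuous. *)

theory Defs
  imports "HOL-Analysis.Analysis"
begin

text \<open>The vertex set of the graph is the whole type \<open>'a\<close>, required to be countably infinite.\<close>

locale weighted_graph =
  fixes \<omega> :: "'a \<Rightarrow> 'a \<Rightarrow> real" and \<mu> :: "'a \<Rightarrow> real"
  assumes countable_vertices: "countable (UNIV :: 'a set)"
    and infinite_vertices: "infinite (UNIV :: 'a set)"
    and measure_pos: "\<mu> x > 0"
    and weight_nonneg: "\<omega> x y \<ge> 0"
    and weight_sym: "\<omega> x y = \<omega> y x"
    and weight_irrefl: "\<omega> x x = 0"
    and weight_summable: "\<omega> x summable_on UNIV"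

definition adjacent :: "('a \<Rightarrow> 'a \<Rightarrow> real) \<Rightarrow> 'a \<Rightarrow> 'a \<Rightarrow> bool" where
  "adjacent \<omega> x y \<longleftrightarrow> \<omega> x y > 0"

definition graph_path :: "('a \<Rightarrow> 'a \<Rightarrow> real) \<Rightarrow> 'a list \<Rightarrow> bool" where
  "graph_path \<omega> xs \<longleftrightarrow> xs \<noteq> [] \<and> successively (adjacent \<omega>) xs"

definition graph_connected :: "('a \<Rightarrow> 'a \<Rightarrow> real) \<Rightarrow> bool" where
  "graph_connected \<omega> \<longleftrightarrow>
     (\<forall>x y. x \<noteq> y \<longrightarrow> (\<exists>xs. graph_path \<omega> xs \<and> hd xs = x \<and> last xs = y))"

definition graph_locally_finite :: "('a \<Rightarrow> 'a \<Rightarrow> real) \<Rightarrow> bool" where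
  "graph_locally_finite \<omega> \<longleftrightarrow> (\<forall>x. finite {y. adjacent \<omega> x y})"

text \<open>\<open>infsum\<close> is \<open>0\<close> for non-summable families; on a locally finite graph the sum has only
  finitely many nonzero terms, so every function has a meaningful Laplacian.\<close>

definition laplacian ::
    "('a \<Rightarrow> 'a \<Rightarrow> real) \<Rightarrow> ('a \<Rightarrow> real) \<Rightarrow> ('a \<Rightarrow> real) \<Rightarrow> 'a \<Rightarrow> real" where
  "laplacian \<omega> \<mu> f x = 1 / \<mu> x * (\<Sum>\<^sub>\<infinity>y. (f y - f x) * \<omega> x y)"

definition subsolution ::
    "('a \<Rightarrow> 'a \<Rightarrow> real) \<Rightarrow> ('a \<Rightarrow> real) \<Rightarrow> ('a \<Rightarrow> real) \<Rightarrow> ('a \<Rightarrow> real) \<Rightarrow> bool" where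
  "subsolution \<omega> \<mu> V u \<longleftrightarrow> (\<forall>x. laplacian \<omega> \<mu> u x - V x * u x \<ge> 0)"

text \<open>The filter of the limits \<open>d(x, x\<^sub>0) \<rightarrow> +\<infinity>\<close>: a property of \<open>x\<close> holds eventually iff there is an
  \<open>R\<close> such that it holds whenever \<open>d(x, x\<^sub>0) \<ge> R\<close>. It is the trivial filter if \<open>d\<close> is bounded.\<close>

definition far_from :: "('a \<Rightarrow> 'a \<Rightarrow> real) \<Rightarrow> 'a \<Rightarrow> 'a filter" where
  "far_from d x0 = filtercomap (\<lambda>x. d x x0) at_top"

end

theory Submission
  imports Defs
begin

text \<open>
  Subtracting from \<open>Z\<close> a constant \<open>b\<close> so large that \<open>W = Z - b \<le> -1\<close> leaves the Laplacian unchanged,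
  and \<open>V \<ge> 0\<close> turns \<open>\<Delta>Z \<ge> -V\<close> into \<open>\<Delta>W \<ge> -V \<ge> V W\<close>: the function \<open>W\<close> is a negative subsolution
  of \<open>\<Delta>w - V w = 0\<close> that tends to \<open>-\<infinity>\<close>.
  Hence \<open>v = u + \<epsilon> W\<close> is a subsolution for every \<open>\<epsilon> > 0\<close>. By the growth condition, \<open>u\<close> is eventually
  dominated by \<open>\<epsilon> \<bar>Z\<bar> / 2\<close>, so \<open>v \<le> 0\<close> outside a ball, which is a finite set.

  A subsolution that is positive at only finitely many vertices of an infinite connected graph is
  nonpositive (\<open>subsolution_nonpos_if_finite_pos\<close>): otherwise it attains a positive maximum, where
  \<open>\<Delta>v \<ge> V v \<ge> 0\<close> forces all neighbours to take the same value; connectedness spreads the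
  maximum over the whole infinite graph. So \<open>u \<le> - \<epsilon> W\<close> everywhere, and \<open>\<epsilon> \<rightarrow> 0\<close> gives \<open>u \<le> 0\<close>.
\<close>

context weighted_graph
begin

lemma laplacian_eq_sum_neighbours:
  assumes "graph_locally_finite \<omega>"
  shows "laplacian \<omega> \<mu> f x = 1 / \<mu> x * (\<Sum>y | adjacent \<omega> x y. (f y - f x) * \<omega> x y)"
proof -
  have "\<omega> x y = 0" if "\<not> adjacent \<omega> x y" for y
    using that weight_nonneg[of x y] by (simp add: adjacent_def)
  then have "(\<Sum>\<^sub>\<infinity>y. (f y - f x) * \<omega> x y)
      = (\<Sum>\<^sub>\<infinity>y\<in>{y. adjacent \<omega> x y}. (f y - f x) * \<omega> x y)"
    by (intro infsum_cong_neutral) auto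
  also have "\<dots> = (\<Sum>y | adjacent \<omega> x y. (f y - f x) * \<omega> x y)"
    using assms by (intro infsum_finite) (simp add: graph_locally_finite_def)
  finally show ?thesis
    by (simp add: laplacian_def)
qed

lemma laplacian_add_scaled:
  assumes "graph_locally_finite \<omega>"
  shows "laplacian \<omega> \<mu> (\<lambda>y. f y + c * g y) x = laplacian \<omega> \<mu> f x + c * laplacian \<omega> \<mu> g x"
proof -
  have "(\<Sum>y | adjacent \<omega> x y. ((f y + c * g y) - (f x + c * g x)) * \<omega> x y)
      = (\<Sum>y | adjacent \<omega> x y. (f y - f x) * \<omega> x y)
        + c * (\<Sum>y | adjacent \<omega> x y. (g y - g x) * \<omega> x y)"
    unfolding sum_distrib_left sum.distrib[symmetric]
    by (intro sum.cong refl) (simp add: algebra_simps)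
  then show ?thesis
    unfolding laplacian_eq_sum_neighbours[OF assms] by (simp add: distrib_left)
qed

lemma subsolution_add_scaled:
  assumes "graph_locally_finite \<omega>" "subsolution \<omega> \<mu> V u" "subsolution \<omega> \<mu> V w" "c \<ge> 0"
  shows "subsolution \<omega> \<mu> V (\<lambda>x. u x + c * w x)"
  unfolding subsolution_def
proof
  fix x
  have "laplacian \<omega> \<mu> u x - V x * u x \<ge> 0" "c * (laplacian \<omega> \<mu> w x - V x * w x) \<ge> 0"
    using assms by (simp_all add: subsolution_def)
  then show "laplacian \<omega> \<mu> (\<lambda>x. u x + c * w x) x - V x * (u x + c * w x) \<ge> 0"
    unfolding laplacian_add_scaled[OF assms(1)] by (simp add: algebra_simps)
qed

text \<open>The Laplacian at a maximum is a sum of nonpositive terms, so it can only be nonnegative if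
  each of them vanishes.\<close>

lemma eq_on_neighbours_of_max:
  assumes "graph_locally_finite \<omega>" and max: "\<And>y. f y \<le> f x"
    and "laplacian \<omega> \<mu> f x \<ge> 0" and "adjacent \<omega> x y"
  shows "f y = f x"
proof -
  let ?S = "\<Sum>y | adjacent \<omega> x y. (f x - f y) * \<omega> x y"
  have fin: "finite {y. adjacent \<omega> x y}"
    using assms(1) by (simp add: graph_locally_finite_def)
  have nonneg: "(f x - f z) * \<omega> x z \<ge> 0" for z
    using max[of z] weight_nonneg by simp
  have "laplacian \<omega> \<mu> f x = - (1 / \<mu> x * ?S)"
    unfolding laplacian_eq_sum_neighbours[OF assms(1)] mult_minus_right[symmetric]
      sum_negf[symmetric]
    by (simp add: algebra_simps)
  then have "?S \<le> 0"
    using assms(3) measure_pos[of x] by (simp add: divide_le_0_iff)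
  then have "?S = 0"
    using nonneg by (intro antisym sum_nonneg) auto
  then have "(f x - f y) * \<omega> x y = 0"
    using fin nonneg assms(4) by (simp add: sum_nonneg_eq_0_iff)
  then show ?thesis
    using assms(4) by (simp add: adjacent_def)
qed

lemma graph_connected_induct:
  assumes "graph_connected \<omega>" and "P x" and step: "\<And>y z. P y \<Longrightarrow> adjacent \<omega> y z \<Longrightarrow> P z"
  shows "P y"
proof (cases "x = y")
  case False
  then obtain xs where xs: "graph_path \<omega> xs" "hd xs = x" "last xs = y"
    using assms(1) by (auto simp: graph_connected_def)
  have "P (last xs)" if "xs \<noteq> []" "successively (adjacent \<omega>) xs" "P (hd xs)" for xs
    using that
  proof (induction xs rule: induct_list012)
    case (3 a b zs)
    then have "P b"
      using step[of a b] by simp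
    then show ?case
      using 3 by simp
  qed simp_all
  then show ?thesis
    using xs \<open>P x\<close> by (auto simp: graph_path_def)
qed (use assms(2) in simp)

text \<open>Maximum principle. Finiteness of the positivity set guarantees that a positive supremum is
  attained, and together with the infinitude of the graph it rules out a positive constant.\<close>

lemma subsolution_nonpos_if_finite_pos:
  assumes "graph_connected \<omega>" and lf: "graph_locally_finite \<omega>" and V: "\<And>x. V x \<ge> 0"
    and v: "subsolution \<omega> \<mu> V v" and fin: "finite {x. v x > 0}"
  shows "v x \<le> 0"
proof (rule ccontr)
  assume "\<not> v x \<le> 0"
  then have ne: "{x. v x > 0} \<noteq> {}"
    by (auto simp: not_le)
  obtain m where m: "v m > 0" and "\<And>y. v y > 0 \<Longrightarrow> v y \<le> v m"
    using Max_in[of "v ` {x. v x > 0}"] Max_ge[of "v ` {x. v x > 0}"] fin ne by fastforce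
  then have max: "v y \<le> v m" for y
    by (cases "v y > 0") auto
  have "v y = v m" for y
  proof (rule graph_connected_induct[OF assms(1), where P = "\<lambda>y. v y = v m" and x = m])
    fix y z
    assume y: "v y = v m" and yz: "adjacent \<omega> y z"
    have "laplacian \<omega> \<mu> v y \<ge> V y * v y"
      using v by (simp add: subsolution_def)
    moreover have "V y * v y \<ge> 0"
      using V y m by simp
    ultimately have "laplacian \<omega> \<mu> v y \<ge> 0"
      by linarith
    with eq_on_neighbours_of_max[OF lf _ _ yz, of v] max y show "v z = v m"
      by simp
  qed simp
  then have "v y > 0" for y
    using m by metis
  then have "{x. v x > 0} = UNIV"
    by blast
  then show False
    using fin infinite_vertices by simp
qed

lemma subsolution_diff_const:
  assumes "\<And>x. V x \<ge> 0" and "\<And>x. laplacian \<omega> \<mu> Z x \<ge> - V x" and "\<And>x. Z x - b \<le> -1"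
  shows "subsolution \<omega> \<mu> V (\<lambda>x. Z x - b)"
  unfolding subsolution_def
proof
  fix x
  have "V x * (Z x - b) \<le> V x * (-1)"
    using assms(1,3) by (intro mult_left_mono)
  moreover have "laplacian \<omega> \<mu> (\<lambda>x. Z x - b) x = laplacian \<omega> \<mu> Z x"
    by (simp add: laplacian_def)
  ultimately show "laplacian \<omega> \<mu> (\<lambda>x. Z x - b) x - V x * (Z x - b) \<ge> 0"
    using assms(2)[of x] by simp
qed

end

lemma finite_exceptions_if_eventually_far_from:
  assumes "Metric_space UNIV d" and "\<And>r. finite (Metric_space.mball UNIV d x0 r)"
    and "eventually P (far_from d x0)"
  shows "finite {x. \<not> P x}"
proof -
  obtain R where R: "\<And>x. d x x0 \<ge> R \<Longrightarrow> P x"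
    using assms(3) by (auto simp: far_from_def eventually_filtercomap eventually_at_top_linorder)
  have "{x. \<not> P x} \<subseteq> Metric_space.mball UNIV d x0 R"
  proof
    fix x
    assume "x \<in> {x. \<not> P x}"
    then have "d x x0 < R"
      using R by force
    then show "x \<in> Metric_space.mball UNIV d x0 R"
      using assms(1) by (simp add: Metric_space.in_mball Metric_space.commute)
  qed
  then show ?thesis
    using assms(2) finite_subset by blast
qed

text \<open>Eventually \<open>u\<close> uses up only half of \<open>\<epsilon> \<bar>Z\<bar>\<close>; the other half tends to \<open>+\<infinity>\<close> and absorbs the
  constant \<open>\<epsilon> b\<close>.\<close>

lemma eventually_nonpos_add_scaled_shift:
  fixes u Z :: "'a \<Rightarrow> real"
  assumes "filterlim Z at_bot F" and "Limsup F (\<lambda>x. ereal (u x / \<bar>Z x\<bar>)) \<le> 0" and "\<epsilon> > 0"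
  shows "eventually (\<lambda>x. u x + \<epsilon> * (Z x - b) \<le> 0) F"
proof -
  have "Limsup F (\<lambda>x. ereal (u x / \<bar>Z x\<bar>)) < ereal (\<epsilon> / 2)"
    using assms(2,3) by (simp add: le_less_trans)
  then have "eventually (\<lambda>x. ereal (u x / \<bar>Z x\<bar>) < ereal (\<epsilon> / 2)) F"
    by (rule Limsup_lessD)
  moreover have "eventually (\<lambda>x. Z x \<le> min (-1) (2 * b)) F"
    using assms(1) unfolding filterlim_at_bot by blast
  ultimately show ?thesis
  proof eventually_elim
    case (elim x)
    then have "u x / \<bar>Z x\<bar> < \<epsilon> / 2" "\<bar>Z x\<bar> > 0"
      by simp_all
    then have "u x \<le> \<epsilon> / 2 * \<bar>Z x\<bar>"
      using pos_divide_less_eq less_imp_le by metis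
    then have "u x + \<epsilon> * (Z x - b) \<le> \<epsilon> / 2 * (Z x - 2 * b)"
      using elim by (simp add: algebra_simps)
    also have "\<dots> \<le> 0"
      using elim assms(3) by (simp add: mult_le_0_iff)
    finally show ?case .
  qed
qed

theorem proposition3p2:
  fixes \<omega> :: "'a \<Rightarrow> 'a \<Rightarrow> real" and \<mu> :: "'a \<Rightarrow> real"
    and d :: "'a \<Rightarrow> 'a \<Rightarrow> real" and V Z u :: "'a \<Rightarrow> real" and x0 :: 'a
  assumes "weighted_graph \<omega> \<mu>"
    and "graph_connected \<omega>"
    and "graph_locally_finite \<omega>"
    and "Metric_space UNIV d"
    and finite_balls: "\<And>r. finite (Metric_space.mball UNIV d x0 r)"
    and "\<And>x. V x \<ge> 0"
    and "bdd_above (range Z)"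
    and "\<And>x. laplacian \<omega> \<mu> Z x \<ge> - V x"
    and "filterlim Z at_bot (far_from d x0)"
    and "subsolution \<omega> \<mu> V u"
    and "Limsup (far_from d x0) (\<lambda>x. ereal (u x / \<bar>Z x\<bar>)) \<le> 0"
  shows "\<forall>x. u x \<le> 0"
proof
  fix x
  interpret weighted_graph \<omega> \<mu> by fact
  obtain C where C: "\<And>x. Z x \<le> C"
    using assms(7) by (auto simp: bdd_above_def)
  define W where "W = (\<lambda>x. Z x - (C + 1))"
  have W_le: "W x \<le> -1" for x
    using C[of x] by (simp add: W_def)
  have W: "subsolution \<omega> \<mu> V W"
    using subsolution_diff_const[OF assms(6,8)] W_le unfolding W_def by blast
  have bound: "u x + \<epsilon> * W x \<le> 0" if "\<epsilon> > 0" for \<epsilon>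
  proof (rule subsolution_nonpos_if_finite_pos[OF assms(2,3,6)])
    show "subsolution \<omega> \<mu> V (\<lambda>x. u x + \<epsilon> * W x)"
      using subsolution_add_scaled[OF assms(3,10) W] that by simp
    show "finite {x. u x + \<epsilon> * W x > 0}"
      using finite_exceptions_if_eventually_far_from[OF assms(4,5)
          eventually_nonpos_add_scaled_shift[OF assms(9,11) that, of "C + 1"]]
      by (simp add: W_def not_le)
  qed
  show "u x \<le> 0"
  proof (rule ccontr)
    assume "\<not> u x \<le> 0"
    \<comment> \<open>This \<open>\<epsilon>\<close> makes \<open>\<epsilon> * W x = - u x / 2\<close>.\<close>
    then have "u x / (2 * - W x) > 0"
      using W_le[of x] by (intro divide_pos_pos) auto
    from bound[OF this] show False
      using W_le[of x] \<open>\<not> u x \<le> 0\<close> by (simp add: field_simps)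
  qed
qed

end
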